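(* Let $K\geqslant 1$, let $\mathbb{T}$ be a non-empty linearly ordered set and let $\{(X_t,d_t): t\in\mathbb{T}\}$ be a family of semimetric spaces, all satisfying the $K$-relaxed polygonal inequality with the same constant $K$, which is increasing, i.e. for all $s\leqslant t$ in $\mathbb{T}$ we have $X_s\subseteq X_t$ and $d_s(x,y)=d_t(x,y)$ for all $x,y\in X_s$. Define $$X:=\bigcup_{t\in\mathbb{T}}X_t,\qquad d(x,y):=d_p(x,y),\ \text{ where } p\in\mathbb{T} \text{ is any index such that } x,y\in X_p.$$ Then $(X,d)$ is a semimetric space satisfying the $K$-relaxed polygonal inequality.
   Context: A semimetric space is a non-empty set $X$ with a function $d:X\times X\to[0,+\infty)$ (a semimetric) such that for all $x,y\in X$: $d(x,y)=0$ iff $x=y$, and $d(x,y)=d(y,x)$. For $K\geqslant 1$, a semimetric space $(X,d)$ satisfies the $K$-relaxed polygonal inequality if $d(x_0,x_n)\leqslant K\sum_{i=1}^n d(x_{i-1},x_i)$ for all $n\in\mathbb{N}$, $n\geqslant 1$, and all $x_0,\dots,x_n\in X$. *)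

theory Defs
  imports Complex_Main
begin

definition semimetric_space :: "'a set \<Rightarrow> ('a \<Rightarrow> 'a \<Rightarrow> real) \<Rightarrow> bool" where
  "semimetric_space X d \<longleftrightarrow> X \<noteq> {} \<and>
     (\<forall>x\<in>X. \<forall>y\<in>X. 0 \<le> d x y \<and> (d x y = 0 \<longleftrightarrow> x = y) \<and> d x y = d y x)"

definition relaxed_polygonal :: "real \<Rightarrow> 'a set \<Rightarrow> ('a \<Rightarrow> 'a \<Rightarrow> real) \<Rightarrow> bool" where
  "relaxed_polygonal K X d \<longleftrightarrow>
     (\<forall>n\<ge>1. \<forall>x :: nat \<Rightarrow> 'a. (\<forall>i\<le>n. x i \<in> X) \<longrightarrow>
        d (x 0) (x n) \<le> K * (\<Sum>i=1..n. d (x (i - 1)) (x i)))"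

text \<open>The relation \<open>r\<close> is the linear order on the index set: \<open>(s, t) \<in> r\<close> means \<open>s \<le> t\<close>.\<close>

definition increasing_family ::
    "'i rel \<Rightarrow> ('i \<Rightarrow> 'a set) \<Rightarrow> ('i \<Rightarrow> 'a \<Rightarrow> 'a \<Rightarrow> real) \<Rightarrow> bool" where
  "increasing_family r X d \<longleftrightarrow>
     (\<forall>(s, t)\<in>r. X s \<subseteq> X t \<and> (\<forall>x\<in>X s. \<forall>y\<in>X s. d s x y = d t x y))"

text \<open>Outside the union of the \<open>X t\<close> the value is unspecified. That an index \<open>p\<close> exists for points
  of the union, and that the value does not depend on its choice, is not built into the definition.\<close>

definition union_dist ::
    "'i set \<Rightarrow> ('i \<Rightarrow> 'a set) \<Rightarrow> ('i \<Rightarrow> 'a \<Rightarrow> 'a \<Rightarrow> real) \<Rightarrow> 'a \<Rightarrow> 'a \<Rightarrow> real" where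
  "union_dist T X d x y = d (SOME p. p \<in> T \<and> x \<in> X p \<and> y \<in> X p) x y"

end

theory Submission
  imports Defs
begin

text \<open>
  Every axiom to be verified for the union speaks about finitely many points only: two for the
  semimetric axioms, \<open>n + 1\<close> for the polygonal inequality along a chain of length \<open>n\<close>.
  Since the spaces are nested along a linear order, finitely many points of the union lie in one
  common \<open>X p\<close> (\<open>finite_subset_common_member\<close>), and on that space the distance of the union
  is \<open>d p\<close> (\<open>union_dist_eq\<close>), so the axiom is inherited from \<open>X p\<close>. The constant \<open>K\<close> survives
  unchanged because it is the same for all indices and the chain never has to be split
  between different spaces.
\<close>

lemma increasing_family_comparable:
  assumes "linear_order_on T r" and "increasing_family r X d" and "s \<in> T" and "t \<in> T"
  shows "X s \<subseteq> X t \<and> (\<forall>x\<in>X s. \<forall>y\<in>X s. d s x y = d t x y) \<or>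
    X t \<subseteq> X s \<and> (\<forall>x\<in>X t. \<forall>y\<in>X t. d t x y = d s x y)"
proof (cases "s = t")
  case False
  with assms(1,3,4) have "(s, t) \<in> r \<or> (t, s) \<in> r"
    by (auto simp: linear_order_on_def total_on_def)
  then show ?thesis
    using assms(2) unfolding increasing_family_def by blast
qed simp

text \<open>A nonempty chain of sets is directed, so a finite part of its union is caught by a
  single member.\<close>

lemma finite_subset_common_member:
  assumes "linear_order_on T r" and "increasing_family r X d" and "T \<noteq> {}"
    and "finite A" and "A \<subseteq> (\<Union>t\<in>T. X t)"
  shows "\<exists>p\<in>T. A \<subseteq> X p"
proof -
  have "X s \<subseteq> X t \<or> X t \<subseteq> X s" if "s \<in> T" and "t \<in> T" for s t
    using increasing_family_comparable[OF assms(1,2) that] by blast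
  then have "subset.chain UNIV (X ` T)"
    unfolding subset_chain_def by blast
  moreover have "X ` T \<noteq> {}"
    using assms(3) by simp
  ultimately obtain B where "B \<in> X ` T" and "A \<subseteq> B"
    using finite_subset_Union_chain[OF assms(4,5)] by metis
  then show ?thesis
    by blast
qed

text \<open>Two spaces containing both points are nested, and the larger one extends the distance of
  the smaller one; hence the index picked by the choice operator can be traded for any other.\<close>

lemma union_dist_eq:
  assumes "linear_order_on T r" and "increasing_family r X d"
    and "p \<in> T" and "x \<in> X p" and "y \<in> X p"
  shows "union_dist T X d x y = d p x y"
proof -
  define q where "q = (SOME q. q \<in> T \<and> x \<in> X q \<and> y \<in> X q)"
  have q: "q \<in> T \<and> x \<in> X q \<and> y \<in> X q"
    unfolding q_def by (rule someI_ex) (use assms(3-5) in blast)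
  then have "d q x y = d p x y"
    using increasing_family_comparable[OF assms(1,2), of q p] assms(3-5) by auto
  then show ?thesis
    by (simp add: union_dist_def q_def)
qed

lemma semimetric_space_Union:
  assumes "linear_order_on T r" and "increasing_family r X d" and "T \<noteq> {}"
    and semimetric: "\<And>t. t \<in> T \<Longrightarrow> semimetric_space (X t) (d t)"
  shows "semimetric_space (\<Union>t\<in>T. X t) (union_dist T X d)"
  unfolding semimetric_space_def
proof (rule conjI; (intro ballI)?)
  obtain t where "t \<in> T"
    using \<open>T \<noteq> {}\<close> by blast
  with semimetric[of t] show "(\<Union>t\<in>T. X t) \<noteq> {}"
    by (auto simp: semimetric_space_def)
next
  fix x y assume "x \<in> (\<Union>t\<in>T. X t)" and "y \<in> (\<Union>t\<in>T. X t)"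
  then have sub: "{x, y} \<subseteq> (\<Union>t\<in>T. X t)"
    by blast
  obtain p where "p \<in> T" "{x, y} \<subseteq> X p"
    using finite_subset_common_member[OF assms(1-3) _ sub] by auto
  then have p: "p \<in> T" "x \<in> X p" "y \<in> X p"
    by simp_all
  then have "union_dist T X d x y = d p x y" and "union_dist T X d y x = d p y x"
    using union_dist_eq[OF assms(1,2) p(1)] by simp_all
  then show "0 \<le> union_dist T X d x y \<and> (union_dist T X d x y = 0 \<longleftrightarrow> x = y) \<and>
      union_dist T X d x y = union_dist T X d y x"
    using semimetric[OF p(1)] p(2,3) by (simp add: semimetric_space_def)
qed

lemma relaxed_polygonal_Union:
  fixes X :: "'i \<Rightarrow> 'a set"
  assumes "linear_order_on T r" and "increasing_family r X d" and "T \<noteq> {}"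
    and polygonal: "\<And>t. t \<in> T \<Longrightarrow> relaxed_polygonal K (X t) (d t)"
  shows "relaxed_polygonal K (\<Union>t\<in>T. X t) (union_dist T X d)"
  unfolding relaxed_polygonal_def
proof (intro allI impI)
  fix n :: nat and x :: "nat \<Rightarrow> 'a"
  assume n: "1 \<le> n" and "\<forall>i\<le>n. x i \<in> (\<Union>t\<in>T. X t)"
  then have sub: "x ` {..n} \<subseteq> (\<Union>t\<in>T. X t)"
    by blast
  obtain p where p: "p \<in> T" "x ` {..n} \<subseteq> X p"
    using finite_subset_common_member[OF assms(1-3) _ sub] by auto
  have eq: "union_dist T X d (x i) (x j) = d p (x i) (x j)" if "i \<le> n" "j \<le> n" for i j
    using that p(2) by (intro union_dist_eq[OF assms(1,2) p(1)]) auto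
  have "d p (x 0) (x n) \<le> K * (\<Sum>i=1..n. d p (x (i - 1)) (x i))"
    using polygonal[OF p(1)] p(2) n unfolding relaxed_polygonal_def by auto
  moreover have "(\<Sum>i=1..n. union_dist T X d (x (i - 1)) (x i)) =
      (\<Sum>i=1..n. d p (x (i - 1)) (x i))"
    by (intro sum.cong) (auto simp: eq)
  ultimately show "union_dist T X d (x 0) (x n) \<le>
      K * (\<Sum>i=1..n. union_dist T X d (x (i - 1)) (x i))"
    by (simp add: eq)
qed

theorem lemma5p3:
  fixes K :: real
    and T :: "'i set" and r :: "'i rel"
    and X :: "'i \<Rightarrow> 'a set" and d :: "'i \<Rightarrow> 'a \<Rightarrow> 'a \<Rightarrow> real"
  assumes "K \<ge> 1"
    and "T \<noteq> {}" and "linear_order_on T r"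
    and "\<And>t. t \<in> T \<Longrightarrow> semimetric_space (X t) (d t)"
    and "\<And>t. t \<in> T \<Longrightarrow> relaxed_polygonal K (X t) (d t)"
    and "increasing_family r X d"
  shows "(\<forall>x\<in>(\<Union>t\<in>T. X t). \<forall>y\<in>(\<Union>t\<in>T. X t). \<exists>p\<in>T. x \<in> X p \<and> y \<in> X p) \<and>
    (\<forall>p\<in>T. \<forall>x\<in>X p. \<forall>y\<in>X p. union_dist T X d x y = d p x y) \<and>
    semimetric_space (\<Union>t\<in>T. X t) (union_dist T X d) \<and>
    relaxed_polygonal K (\<Union>t\<in>T. X t) (union_dist T X d)"
proof (intro conjI ballI)
  fix x y assume "x \<in> (\<Union>t\<in>T. X t)" and "y \<in> (\<Union>t\<in>T. X t)"
  then have sub: "{x, y} \<subseteq> (\<Union>t\<in>T. X t)"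
    by blast
  obtain p where "p \<in> T" "{x, y} \<subseteq> X p"
    using finite_subset_common_member[OF assms(3,6,2) _ sub] by auto
  then show "\<exists>p\<in>T. x \<in> X p \<and> y \<in> X p"
    by blast
next
  fix p x y assume "p \<in> T" and "x \<in> X p" and "y \<in> X p"
  then show "union_dist T X d x y = d p x y"
    by (rule union_dist_eq[OF assms(3,6)])
next
  show "semimetric_space (\<Union>t\<in>T. X t) (union_dist T X d)"
    by (rule semimetric_space_Union[OF assms(3,6,2,4)])
next
  show "relaxed_polygonal K (\<Union>t\<in>T. X t) (union_dist T X d)"
    by (rule relaxed_polygonal_Union[OF assms(3,6,2,5)])
qed

end
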